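(* For all fixed $n\ge 2$ and $k\ge 2$, it requires at least $\Omega(k^n)$ queries to the input oracle (value or cost) to answer some $\textsc{Val}_\gamma$, $\textsc{Cst}_\gamma$ and $\textsc{Det}_\gamma$ queries.
   Context: Setting. There are $n$ agents; write $[\ell]=\{1,\dots,\ell\}$. Each agent $i\in[n]$ has a signal $s_i\in[k]$; $\mathbf s=(s_1,\dots,s_n)\in[k]^n$ is a signal profile and $\mathbf s_{-i}$ denotes all signals but the $i$-th. An instance consists of value functions $v_i:[k]^n\to\mathbb R_{>0}$ (allocating a good) or cost functions $c_i:[k]^n\to\mathbb R_{>0}$ (allocating a chore); the two are identified via $v_i(\mathbf s)c_i(\mathbf s)=1$. Performance ratios: $\rho_i(\mathbf s)=\frac{v_i(\mathbf s)}{\max_{j}v_j(\mathbf s)}=\frac{\min_j c_j(\mathbf s)}{c_i(\mathbf s)}\in(0,1]$. Signal orders: $\sigma_i(\mathbf s_{-i})=\{(s_i,s_i')\in[k]^2: v_i(s_i,\mathbf s_{-i})<v_i(s_i',\mathbf s_{-i})\}$. Truthful polytope: $\mathcal T(\boldsymbol\sigma)$ is the set of $\mathbf x=(x_i(\mathbf s))_{i\in[n],\mathbf s\in[k]^n}$ with $x_i(\mathbf s)\ge 0$ for all $i,\mathbf s$; $\sum_{i\in[n]}x_i(\mathbf s)=1$ for all $\mathbf s$; and $x_i(s_i,\mathbf s_{-i})\le x_i(s_i',\mathbf s_{-i})$ for all $i$, $\mathbf s_{-i}\in[k]^{n-1}$ and $(s_i,s_i')\in\sigma_i(\mathbf s_{-i})$.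 Deterministic version: $\mathcal T_D(\boldsymbol\sigma)=\{\mathbf x\in\mathcal T(\boldsymbol\sigma): x_i(\mathbf s)\in\{0,1\}\ \forall i,\mathbf s\}$. Approximation ratios: $R_V(\boldsymbol\rho,\mathbf x)=\max_{\mathbf s}\frac{1}{\sum_i x_i(\mathbf s)\rho_i(\mathbf s)}$ and $R_C(\boldsymbol\rho,\mathbf x)=\max_{\mathbf s}\sum_i x_i(\mathbf s)/\rho_i(\mathbf s)$; they coincide when $\mathbf x$ is deterministic, and are then written $R(\boldsymbol\rho,\mathbf x)$. Query problems, for $\gamma\ge1$. $\textsc{Val}_\gamma$: under the promise that some $\mathbf x\in\mathcal T(\boldsymbol\sigma)$ has $R_V(\boldsymbol\rho,\mathbf x)\le\gamma$, answer evaluation queries "given $\mathbf s$, return $\mathbf x(\mathbf s)=(x_i(\mathbf s))_{i\in[n]}$" for one such $\mathbf x$, consistently across queries (all answers come from the same $\mathbf x$). $\textsc{Cst}_\gamma$: the same with $R_C$. $\textsc{Det}_\gamma$: the same with $\mathbf x\in\mathcal T_D(\boldsymbol\sigma)$ and $R$. An algorithm may fail or not terminate on instances violating the promise. One $\textsc{Val}_\gamma$ (resp. $\textsc{Cst}_\gamma$, $\textsc{Det}_\gamma$) query corresponds to computing the outcome at one signal profile. Query complexity: the algorithm has access to the value or cost functions only through an oracle, and may perform arbitrarily many arithmetic operations; the complexity is measured as the number of oracle queries necessary to distinguish between several instances which have different outputs (this corresponds to the algebraic decision tree model). *)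

theory Defs
  imports Complex_Main "HOL-Library.FuncSet"
begin

text \<open>
  Agents are the elements of \<open>{1..n}\<close>, signals the elements of \<open>{1..k}\<close>. Since \<open>n\<close> and \<open>k\<close> are
  quantified inside the statement, profiles are extensional functions and not vectors of a
  fixed type.
\<close>

type_synonym profile = "nat \<Rightarrow> nat"
type_synonym valuation = "nat \<Rightarrow> profile \<Rightarrow> real"
type_synonym allocation = "nat \<Rightarrow> profile \<Rightarrow> real"
type_synonym outcome = "nat \<Rightarrow> real"

definition profiles :: "nat \<Rightarrow> nat \<Rightarrow> profile set" where
  "profiles n k = {1..n} \<rightarrow>\<^sub>E {1..k}"

definition others :: "nat \<Rightarrow> nat \<Rightarrow> nat \<Rightarrow> profile set" where
  "others n k i = ({1..n} - {i}) \<rightarrow>\<^sub>E {1..k}"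

text \<open>An instance is given by its value functions; its cost functions are the reciprocals.\<close>

definition is_instance :: "nat \<Rightarrow> nat \<Rightarrow> valuation \<Rightarrow> bool" where
  "is_instance n k v \<longleftrightarrow> (\<forall>i\<in>{1..n}. \<forall>s\<in>profiles n k. v i s > 0)"

definition cost :: "valuation \<Rightarrow> nat \<Rightarrow> profile \<Rightarrow> real" where
  "cost v i s = 1 / v i s"

definition perf_ratio :: "nat \<Rightarrow> valuation \<Rightarrow> nat \<Rightarrow> profile \<Rightarrow> real" where
  "perf_ratio n v i s = v i s / Max ((\<lambda>j. v j s) ` {1..n})"

text \<open>For \<open>r \<in> others n k i\<close>, the profile \<open>(a, r)\<close> is \<open>r(i := a)\<close>.\<close>

definition signal_order :: "nat \<Rightarrow> valuation \<Rightarrow> nat \<Rightarrow> profile \<Rightarrow> (nat \<times> nat) set" where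
  "signal_order k v i r =
     {(a, b). a \<in> {1..k} \<and> b \<in> {1..k} \<and> v i (r(i := a)) < v i (r(i := b))}"

definition truthful ::
    "nat \<Rightarrow> nat \<Rightarrow> (nat \<Rightarrow> profile \<Rightarrow> (nat \<times> nat) set) \<Rightarrow> allocation set" where
  "truthful n k \<sigma> =
     {x. (\<forall>i\<in>{1..n}. \<forall>s\<in>profiles n k. x i s \<ge> 0) \<and>
         (\<forall>s\<in>profiles n k. (\<Sum>i\<in>{1..n}. x i s) = 1) \<and>
         (\<forall>i\<in>{1..n}. \<forall>r\<in>others n k i. \<forall>(a, b)\<in>\<sigma> i r. x i (r(i := a)) \<le> x i (r(i := b)))}"

definition truthful_det ::
    "nat \<Rightarrow> nat \<Rightarrow> (nat \<Rightarrow> profile \<Rightarrow> (nat \<times> nat) set) \<Rightarrow> allocation set" where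
  "truthful_det n k \<sigma> =
     {x \<in> truthful n k \<sigma>. \<forall>i\<in>{1..n}. \<forall>s\<in>profiles n k. x i s \<in> {0, 1}}"

definition approx_V :: "nat \<Rightarrow> nat \<Rightarrow> (nat \<Rightarrow> profile \<Rightarrow> real) \<Rightarrow> allocation \<Rightarrow> real" where
  "approx_V n k \<rho> x = Max ((\<lambda>s. 1 / (\<Sum>i\<in>{1..n}. x i s * \<rho> i s)) ` profiles n k)"

definition approx_C :: "nat \<Rightarrow> nat \<Rightarrow> (nat \<Rightarrow> profile \<Rightarrow> real) \<Rightarrow> allocation \<Rightarrow> real" where
  "approx_C n k \<rho> x = Max ((\<lambda>s. \<Sum>i\<in>{1..n}. x i s / \<rho> i s) ` profiles n k)"

datatype problem = Val | Cst | Det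

text \<open>For \<open>Det\<close>, either ratio may be used: they coincide on deterministic allocations.\<close>

fun solution :: "problem \<Rightarrow> nat \<Rightarrow> nat \<Rightarrow> real \<Rightarrow> valuation \<Rightarrow> allocation \<Rightarrow> bool" where
  "solution Val n k \<gamma> v x \<longleftrightarrow>
     x \<in> truthful n k (signal_order k v) \<and> approx_V n k (perf_ratio n v) x \<le> \<gamma>"
| "solution Cst n k \<gamma> v x \<longleftrightarrow>
     x \<in> truthful n k (signal_order k v) \<and> approx_C n k (perf_ratio n v) x \<le> \<gamma>"
| "solution Det n k \<gamma> v x \<longleftrightarrow>
     x \<in> truthful_det n k (signal_order k v) \<and> approx_V n k (perf_ratio n v) x \<le> \<gamma>"

definition promise :: "problem \<Rightarrow> nat \<Rightarrow> nat \<Rightarrow> real \<Rightarrow> valuation \<Rightarrow> bool" where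
  "promise P n k \<gamma> v \<longleftrightarrow> is_instance n k v \<and> (\<exists>x. solution P n k \<gamma> v x)"

text \<open>
  Algorithms are deterministic decision trees. A node \<open>Ask q f\<close> puts \<open>q\<close> to the input oracle and
  continues with \<open>f\<close> applied to the reply; as \<open>f\<close> is an arbitrary function, computation on the
  replies is free. A node \<open>Answer out A\<close> answers the current evaluation query with \<open>out\<close> and
  waits for the next one, so that everything learnt so far may be remembered. The type is
  coinductive because an algorithm need not terminate when the promise is violated.
\<close>

codatatype ('q, 'a) computation =
    Ask 'q "'a \<Rightarrow> ('q, 'a) computation"
  | Answer outcome "profile \<Rightarrow> ('q, 'a) computation"

type_synonym ('q, 'a) algorithm = "profile \<Rightarrow> ('q, 'a) computation"

text \<open>
  \<open>finishes orc T out A m\<close>: with oracle \<open>orc\<close>, \<open>T\<close> reaches the answer \<open>out\<close> after exactly \<open>m\<close> oracle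
  queries, and \<open>A\<close> is ready for the next evaluation query.
\<close>

inductive finishes ::
    "('q \<Rightarrow> 'a) \<Rightarrow> ('q, 'a) computation \<Rightarrow> outcome \<Rightarrow> ('q, 'a) algorithm \<Rightarrow> nat \<Rightarrow> bool"
  for orc where
  "finishes orc (Answer out A) out A 0"
| "finishes orc (f (orc q)) out A m \<Longrightarrow> finishes orc (Ask q f) out A (Suc m)"

inductive session ::
    "('q \<Rightarrow> 'a) \<Rightarrow> ('q, 'a) algorithm \<Rightarrow> profile list \<Rightarrow> outcome list \<Rightarrow> bool"
  for orc where
  "session orc A [] []"
| "finishes orc (A s) out A' m \<Longrightarrow> session orc A' ss outs \<Longrightarrow> session orc A (s # ss) (out # outs)"

definition solves ::
    "(valuation \<Rightarrow> 'q \<Rightarrow> 'a) \<Rightarrow> problem \<Rightarrow> nat \<Rightarrow> nat \<Rightarrow> real \<Rightarrow> ('q, 'a) algorithm \<Rightarrow> bool" where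
  "solves orc P n k \<gamma> A \<longleftrightarrow>
     (\<forall>v. promise P n k \<gamma> v \<longrightarrow>
        (\<forall>ss. set ss \<subseteq> profiles n k \<longrightarrow>
           (\<exists>x outs. solution P n k \<gamma> v x \<and> session (orc v) A ss outs \<and>
              list_all2 (\<lambda>s out. \<forall>i\<in>{1..n}. out i = x i s) ss outs)))"

text \<open>
  Some evaluation query \<open>s\<close> costs every algorithm at least \<open>b\<close> oracle queries in the worst case
  over the instances satisfying the promise. The query \<open>s\<close> comes first in the session, so nothing
  has been learnt before.
\<close>

definition requires_queries ::
    "(valuation \<Rightarrow> 'q \<Rightarrow> 'a) \<Rightarrow> problem \<Rightarrow> nat \<Rightarrow> nat \<Rightarrow> real \<Rightarrow> real \<Rightarrow> bool" where
  "requires_queries orc P n k \<gamma> b \<longleftrightarrow>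
     (\<exists>s\<in>profiles n k. \<forall>A. solves orc P n k \<gamma> A \<longrightarrow>
        (\<exists>v out A' m. promise P n k \<gamma> v \<and> finishes (orc v) (A s) out A' m \<and> b \<le> real m))"

text \<open>Input oracles: a query reveals one number, or the numbers of all agents at one profile.\<close>

definition value_oracle :: "valuation \<Rightarrow> nat \<times> profile \<Rightarrow> real" where
  "value_oracle v = (\<lambda>(i, s). v i s)"

definition cost_oracle :: "valuation \<Rightarrow> nat \<times> profile \<Rightarrow> real" where
  "cost_oracle v = (\<lambda>(i, s). cost v i s)"

definition value_profile_oracle :: "nat \<Rightarrow> valuation \<Rightarrow> profile \<Rightarrow> nat \<Rightarrow> real" where
  "value_profile_oracle n v s = (\<lambda>i\<in>{1..n}. v i s)"

definition cost_profile_oracle :: "nat \<Rightarrow> valuation \<Rightarrow> profile \<Rightarrow> nat \<Rightarrow> real" where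
  "cost_profile_oracle n v s = (\<lambda>i\<in>{1..n}. cost v i s)"

end

theory Submission
  imports Defs
begin

text \<open>
  Take \<open>\<gamma> = 1\<close>, so that the good must go to an agent of maximal value. At every profile exactly
  two agents, agent 1 and some other one, tie for the maximum, and the common value is chosen along
  a Hamiltonian path of the grid \<open>[k]\<^sup>n\<close> such that truthfulness says precisely that the
  probability of agent 1 is nondecreasing along the path. Breaking the tie at a single profile
  then decides the whole path before or after it. So an algorithm answering the query at the
  middle of the path must have looked at every profile of one of the two halves.
\<close>

section \<open>The adversary argument\<close>

text \<open>A run sees only the replies along its own branch of the decision tree. \<open>Q\<close>
  collects the queries on that branch; repetitions can make it smaller than
  \<open>m\<close>.\<close>

lemma finishes_depends_on_queries:
  assumes "finishes orc T out A m"
  shows "\<exists>Q. finite Q \<and> card Q \<le> m \<and>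
           (\<forall>orc'. (\<forall>q\<in>Q. orc' q = orc q) \<longrightarrow> finishes orc' T out A m)"
  using assms
proof induction
  case (1 out A)
  show ?case by (intro exI[of _ "{}"]) (auto intro: finishes.intros(1))
next
  case (2 f q out A m)
  then obtain Q where Q: "finite Q" "card Q \<le> m"
    "\<And>orc'. (\<forall>q\<in>Q. orc' q = orc q) \<Longrightarrow> finishes orc' (f (orc q)) out A m"
    by blast
  have "finishes orc' (Ask q f) out A (Suc m)" if "\<forall>p\<in>insert q Q. orc' p = orc p" for orc'
    using Q(3)[of orc'] that by (simp add: finishes.intros(2))
  moreover have "card (insert q Q) \<le> Suc m"
    using Q(1,2) by (simp add: card_insert_if)
  ultimately show ?case using Q(1) by (intro exI[of _ "insert q Q"]) auto
qed

lemma finishes_deterministic: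
  "finishes orc T out A m \<Longrightarrow> finishes orc T out' A' m' \<Longrightarrow> out' = out"
proof (induction arbitrary: out' A' m' rule: finishes.induct)
  case (1 out A)
  then show ?case by cases
next
  case (2 f q out A m)
  from \<open>finishes orc (Ask q f) out' A' m'\<close> show ?case
    by cases (simp add: "2.IH")
qed

lemma solves_first_answer:
  assumes "solves orc P n k \<gamma> A" "promise P n k \<gamma> v" "s \<in> profiles n k"
  shows "\<exists>x out A' m. solution P n k \<gamma> v x \<and> finishes (orc v) (A s) out A' m \<and>
           (\<forall>i\<in>{1..n}. out i = x i s)"
proof -
  have "set [s] \<subseteq> profiles n k" using assms(3) by simp
  then obtain x outs where x: "solution P n k \<gamma> v x" "session (orc v) A [s] outs"
    "list_all2 (\<lambda>s out. \<forall>i\<in>{1..n}. out i = x i s) [s] outs"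
    using assms(1,2) unfolding solves_def by meson
  from x(2) show ?thesis
  proof cases
    case (2 out A' m outs')
    then show ?thesis using x(1,3) by auto
  qed
qed

text \<open>The map \<open>prof\<close> sends a query to the one profile its reply depends on, so
  that several oracles are treated at once. A run on \<open>v\<close> with fewer than
  \<open>b\<close> queries misses some profile of \<open>B\<close> and some profile of
  \<open>C\<close>. Changing \<open>v\<close> at either one does not alter the run, so its answer
  for agent \<open>j\<close> would have to be both \<alpha> and \<beta>.\<close>

lemma requires_queriesI:
  fixes orc :: "valuation \<Rightarrow> 'q \<Rightarrow> 'a" and prof :: "'q \<Rightarrow> profile"
  assumes local: "\<And>v v' q. (\<And>i. v i (prof q) = v' i (prof q)) \<Longrightarrow> orc v q = orc v' q"
    and s: "s \<in> profiles n k" and j: "j \<in> {1..n}" and "\<alpha> \<noteq> \<beta>"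
    and v: "promise P n k \<gamma> v"
    and B: "b \<le> real (card B)"
      "\<And>t. t \<in> B \<Longrightarrow> \<exists>w. promise P n k \<gamma> w \<and> (\<forall>i u. u \<noteq> t \<longrightarrow> w i u = v i u) \<and>
                        (\<forall>x. solution P n k \<gamma> w x \<longrightarrow> x j s = \<alpha>)"
    and C: "b \<le> real (card C)"
      "\<And>t. t \<in> C \<Longrightarrow> \<exists>w. promise P n k \<gamma> w \<and> (\<forall>i u. u \<noteq> t \<longrightarrow> w i u = v i u) \<and>
                        (\<forall>x. solution P n k \<gamma> w x \<longrightarrow> x j s = \<beta>)"
  shows "requires_queries orc P n k \<gamma> b"
  unfolding requires_queries_def
proof (intro bexI[of _ s] s allI impI)
  fix A :: "('q, 'a) algorithm"
  assume A: "solves orc P n k \<gamma> A"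
  obtain x out A' m where fin: "finishes (orc v) (A s) out A' m"
    using solves_first_answer[OF A v s] by blast
  then obtain Q where Q: "finite Q" "card Q \<le> m"
    "\<And>orc'. (\<forall>q\<in>Q. orc' q = orc v q) \<Longrightarrow> finishes orc' (A s) out A' m"
    using finishes_depends_on_queries[OF fin] by blast
  have answer: "out j = \<epsilon>"
    if D: "b \<le> real (card D)" and small: "real m < b"
      and force: "\<And>t. t \<in> D \<Longrightarrow> \<exists>w. promise P n k \<gamma> w \<and> (\<forall>i u. u \<noteq> t \<longrightarrow> w i u = v i u) \<and>
                                   (\<forall>x. solution P n k \<gamma> w x \<longrightarrow> x j s = \<epsilon>)"
    for D \<epsilon>
  proof -
    \<comment> \<open>Distinct queries may concern the same profile, hence only an upper bound on
      the number of inspected profiles.\<close>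
    have "card (prof ` Q) \<le> m" using Q(1,2) card_image_le le_trans by blast
    with D small have "card (prof ` Q) < card D" by linarith
    then have "\<not> D \<subseteq> prof ` Q"
      using Q(1) by (meson card_mono finite_imageI not_le)
    then obtain t where t: "t \<in> D" "t \<notin> prof ` Q" by blast
    obtain w where w: "promise P n k \<gamma> w" "\<And>i u. u \<noteq> t \<Longrightarrow> w i u = v i u"
      "\<And>x. solution P n k \<gamma> w x \<Longrightarrow> x j s = \<epsilon>"
      using force[OF t(1)] by blast
    have "orc w q = orc v q" if "q \<in> Q" for q
    proof (rule local)
      have "prof q \<noteq> t" using t(2) that by blast
      then show "w i (prof q) = v i (prof q)" for i by (rule w(2))
    qed
    then have "finishes (orc w) (A s) out A' m" using Q(3) by simp
    moreover obtain y out' A'' m' where y: "solution P n k \<gamma> w y"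
      "finishes (orc w) (A s) out' A'' m'" "\<forall>i\<in>{1..n}. out' i = y i s"
      using solves_first_answer[OF A w(1) s] by blast
    ultimately have "out' = out" using finishes_deterministic by blast
    then show ?thesis using y(3) j w(3)[OF y(1)] by simp
  qed
  have "b \<le> real m"
  proof (rule ccontr)
    assume "\<not> b \<le> real m"
    then have "out j = \<alpha>" "out j = \<beta>"
      using answer[OF B(1) _ B(2)] answer[OF C(1) _ C(2)] by (simp_all add: not_le)
    with \<open>\<alpha> \<noteq> \<beta>\<close> show False by simp
  qed
  with v fin show "\<exists>v out A' m. promise P n k \<gamma> v \<and> finishes (orc v) (A s) out A' m \<and> b \<le> real m"
    by blast
qed

section \<open>Optimal truthful allocations\<close>

lemma finite_profiles: "finite (profiles n k)"
  unfolding profiles_def by (intro finite_PiE) auto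

lemma card_profiles: "card (profiles n k) = k ^ n"
  unfolding profiles_def by (simp add: card_PiE)

lemma profiles_nonempty: "k \<ge> 1 \<Longrightarrow> profiles n k \<noteq> {}"
  unfolding profiles_def by (auto simp: PiE_eq_empty_iff)

lemma perf_ratio_bounds:
  assumes "is_instance n k v" "s \<in> profiles n k" "i \<in> {1..n}"
  shows "0 < perf_ratio n v i s" "perf_ratio n v i s \<le> 1"
    "perf_ratio n v i s = 1 \<longleftrightarrow> (\<forall>j\<in>{1..n}. v j s \<le> v i s)"
proof -
  have pos: "0 < v i s" using assms by (auto simp: is_instance_def)
  have le: "v i s \<le> Max ((\<lambda>j. v j s) ` {1..n})" using assms(3) by (intro Max_ge) auto
  show "0 < perf_ratio n v i s" "perf_ratio n v i s \<le> 1"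
    using pos le by (auto simp: perf_ratio_def)
  have "perf_ratio n v i s = 1 \<longleftrightarrow> Max ((\<lambda>j. v j s) ` {1..n}) = v i s"
    using pos le by (auto simp: perf_ratio_def divide_simps)
  also have "\<dots> \<longleftrightarrow> (\<forall>j\<in>{1..n}. v j s \<le> v i s)"
    using assms(3) by (subst Max_eq_iff) auto
  finally show "perf_ratio n v i s = 1 \<longleftrightarrow> (\<forall>j\<in>{1..n}. v j s \<le> v i s)" .
qed

text \<open>At ratio 1 the terms \<open>x i s / ?\<rho> i - x i s\<close> (for \<open>Cst\<close>)
  or \<open>x i s - x i s * ?\<rho> i\<close> (otherwise) are nonnegative with sum at most 0, so
  each vanishes. A non-maximal agent has performance ratio different from 1, which leaves only
  probability 0.\<close>

lemma optimal_solution_support: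
  assumes inst: "is_instance n k v" and sol: "solution P n k 1 v x"
    and s: "s \<in> profiles n k" and i: "i \<in> {1..n}" and j: "j \<in> {1..n}" and less: "v i s < v j s"
  shows "x i s = 0"
proof -
  let ?\<rho> = "\<lambda>i. perf_ratio n v i s"
  note \<rho> = perf_ratio_bounds[OF inst s]
  have "x \<in> truthful n k (signal_order k v)"
    using sol by (cases P) (auto simp: truthful_det_def)
  then have x: "\<And>i. i \<in> {1..n} \<Longrightarrow> 0 \<le> x i s" "(\<Sum>i\<in>{1..n}. x i s) = 1"
    using s by (auto simp: truthful_def)
  have ratio: "?\<rho> i \<noteq> 1" using \<rho>(3)[OF i] j less by (auto simp: not_le)
  show ?thesis
  proof (cases "P = Cst")
    case True
    then have "approx_C n k (perf_ratio n v) x \<le> 1" using sol by simp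
    then have "(\<Sum>i\<in>{1..n}. x i s / ?\<rho> i) \<le> 1"
      unfolding approx_C_def using s finite_profiles by (subst (asm) Max_le_iff) auto
    then have "(\<Sum>i\<in>{1..n}. x i s / ?\<rho> i - x i s) \<le> 0" using x(2) by (simp add: sum_subtractf)
    moreover have nonneg: "0 \<le> x i s / ?\<rho> i - x i s" if "i \<in> {1..n}" for i
      using x(1)[OF that] \<rho>(1,2)[OF that] by (simp add: divide_simps mult_left_le)
    ultimately have "x i s / ?\<rho> i - x i s = 0"
      using i sum_nonneg_eq_0_iff[of "{1..n}" "\<lambda>i. x i s / ?\<rho> i - x i s"]
      by (metis (no_types, lifting) finite_atLeastAtMost order_antisym sum_nonneg)
    then show ?thesis using \<rho>(1)[OF i] ratio by (auto simp: divide_simps)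
  next
    case False
    then have "approx_V n k (perf_ratio n v) x \<le> 1" using sol by (cases P) auto
    then have "1 / (\<Sum>i\<in>{1..n}. x i s * ?\<rho> i) \<le> 1"
      unfolding approx_V_def using s finite_profiles by (subst (asm) Max_le_iff) auto
    \<comment> \<open>Since \<open>1 / 0 = 0\<close>, a vanishing sum would meet the bound too;
      positivity excludes it.\<close>
    moreover have "0 < (\<Sum>i\<in>{1..n}. x i s * ?\<rho> i)"
    proof -
      obtain l where l: "l \<in> {1..n}" "x l s \<noteq> 0"
        using x(2) by (metis sum.neutral zero_neq_one)
      then have "0 < x l s * ?\<rho> l" using x(1)[OF l(1)] \<rho>(1)[OF l(1)] by simp
      then show ?thesis using l(1) x(1) \<rho>(1)
        by (intro sum_pos2[of _ l]) (auto simp: less_imp_le intro!: mult_nonneg_nonneg)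
    qed
    ultimately have "1 \<le> (\<Sum>i\<in>{1..n}. x i s * ?\<rho> i)" by (simp add: divide_simps split: if_splits)
    then have "(\<Sum>i\<in>{1..n}. x i s - x i s * ?\<rho> i) \<le> 0" using x(2) by (simp add: sum_subtractf)
    moreover have nonneg: "0 \<le> x i s - x i s * ?\<rho> i" if "i \<in> {1..n}" for i
      using x(1)[OF that] \<rho>(1,2)[OF that] by (simp add: mult_left_le)
    ultimately have "x i s - x i s * ?\<rho> i = 0"
      using i sum_nonneg_eq_0_iff[of "{1..n}" "\<lambda>i. x i s - x i s * ?\<rho> i"]
      by (metis (no_types, lifting) finite_atLeastAtMost order_antisym sum_nonneg)
    then show ?thesis using ratio by simp
  qed
qed

text \<open>Every agent that is served has performance ratio 1, so both weighted sums equal the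
  total probability 1. Being deterministic, the allocation fits all three problems.\<close>

lemma optimal_solutionI:
  assumes inst: "is_instance n k v" and "k \<ge> 1"
    and x: "x \<in> truthful_det n k (signal_order k v)"
    and supp: "\<And>i j s. i \<in> {1..n} \<Longrightarrow> j \<in> {1..n} \<Longrightarrow> s \<in> profiles n k \<Longrightarrow> v i s < v j s \<Longrightarrow> x i s = 0"
  shows "solution P n k 1 v x"
proof -
  have \<rho>: "x i s = 0 \<or> perf_ratio n v i s = 1" if "i \<in> {1..n}" "s \<in> profiles n k" for i s
    using perf_ratio_bounds(3)[OF inst that(2,1)] supp[OF that(1) _ that(2)] by (meson not_le)
  have sum: "(\<Sum>i\<in>{1..n}. x i s) = 1" if "s \<in> profiles n k" for s
    using x that by (auto simp: truthful_det_def truthful_def)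
  have "(\<Sum>i\<in>{1..n}. x i s * perf_ratio n v i s) = 1"
    "(\<Sum>i\<in>{1..n}. x i s / perf_ratio n v i s) = 1" if s: "s \<in> profiles n k" for s
  proof -
    have "(\<Sum>i\<in>{1..n}. x i s * perf_ratio n v i s) = (\<Sum>i\<in>{1..n}. x i s)"
      "(\<Sum>i\<in>{1..n}. x i s / perf_ratio n v i s) = (\<Sum>i\<in>{1..n}. x i s)"
      by (rule sum.cong; use \<rho>[OF _ s] in force)+
    then show "(\<Sum>i\<in>{1..n}. x i s * perf_ratio n v i s) = 1"
      "(\<Sum>i\<in>{1..n}. x i s / perf_ratio n v i s) = 1"
      using sum[OF s] by simp_all
  qed
  then have "approx_V n k (perf_ratio n v) x \<le> 1" "approx_C n k (perf_ratio n v) x \<le> 1"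
    unfolding approx_V_def approx_C_def
    using finite_profiles profiles_nonempty[OF \<open>k \<ge> 1\<close>] by (auto simp: Max_le_iff)
  then show ?thesis using x by (cases P) (auto simp: truthful_det_def)
qed

section \<open>Truthfulness for profiles differing in one coordinate\<close>

lemma truthful_mono:
  assumes x: "x \<in> truthful n k (signal_order k v)" and i: "i \<in> {1..n}"
    and s: "s \<in> profiles n k" "s' \<in> profiles n k"
    and agree: "\<And>j. j \<noteq> i \<Longrightarrow> s j = s' j" and less: "v i s < v i s'"
  shows "x i s \<le> x i s'"
proof -
  \<comment> \<open>Erasing coordinate \<open>i\<close> gives the extensional function that
    \<open>others\<close> requires.\<close>
  let ?r = "s(i := undefined)"
  have eq: "s = ?r(i := s i)" "s' = ?r(i := s' i)" using agree by auto
  have "?r \<in> others n k i"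
    using s(1) by (auto simp: others_def profiles_def PiE_def extensional_def)
  moreover have "(s i, s' i) \<in> signal_order k v i ?r"
    using s i less eq by (auto simp: signal_order_def profiles_def)
  ultimately have "x i (?r(i := s i)) \<le> x i (?r(i := s' i))"
    using x i unfolding truthful_def by fast
  then show ?thesis using eq by simp
qed

lemma truthfulI:
  assumes "\<And>i s. i \<in> {1..n} \<Longrightarrow> s \<in> profiles n k \<Longrightarrow> 0 \<le> x i s"
    and "\<And>s. s \<in> profiles n k \<Longrightarrow> (\<Sum>i\<in>{1..n}. x i s) = 1"
    and mono: "\<And>i s s'. i \<in> {1..n} \<Longrightarrow> s \<in> profiles n k \<Longrightarrow> s' \<in> profiles n k \<Longrightarrow>
      (\<And>j. j \<noteq> i \<Longrightarrow> s j = s' j) \<Longrightarrow> v i s < v i s' \<Longrightarrow> x i s \<le> x i s'"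
  shows "x \<in> truthful n k (signal_order k v)"
proof -
  have "r(i := a) \<in> profiles n k" if "i \<in> {1..n}" "r \<in> others n k i" "a \<in> {1..k}" for i r a
    using that by (auto simp: others_def profiles_def PiE_def extensional_def)
  then have "x i (r(i := a)) \<le> x i (r(i := b))"
    if "i \<in> {1..n}" "r \<in> others n k i" "(a, b) \<in> signal_order k v i r" for i r a b
    using that by (intro mono) (auto simp: signal_order_def)
  then show ?thesis using assms(1,2) by (auto simp: truthful_def)
qed

section \<open>Instances that force a monotone chain\<close>

text \<open>Here \<open>pos\<close> is the index on the path, \<open>M\<close> the common value of
  the two tied agents and \<open>a\<close> the partner of agent 1. By \<open>up\<close> and
  \<open>down\<close>, every truthfulness constraint of a tied agent agrees with the direction of
  the path, so step functions along it are truthful. By \<open>step\<close>, each pair of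
  consecutive profiles really is constrained, either through agent 1 or through a shared
  partner.\<close>

locale tied_chain =
  fixes n k :: nat and pos :: "profile \<Rightarrow> nat" and M :: "profile \<Rightarrow> nat" and a :: "profile \<Rightarrow> nat"
  assumes k: "k \<ge> 1" and n: "n \<ge> 1"
    and pos: "bij_betw pos (profiles n k) {..<k ^ n}"
    and M_ge: "s \<in> profiles n k \<Longrightarrow> M s \<ge> 2"
    and M_inj: "inj_on M (profiles n k)"
    and a: "s \<in> profiles n k \<Longrightarrow> a s \<in> {2..n}"
    and up: "\<lbrakk>s \<in> profiles n k; s' \<in> profiles n k; \<And>j. j \<noteq> 1 \<Longrightarrow> s j = s' j; M s < M s'\<rbrakk>
      \<Longrightarrow> pos s < pos s'"
    and down: "\<lbrakk>s \<in> profiles n k; s' \<in> profiles n k; i \<noteq> 1; \<And>j. j \<noteq> i \<Longrightarrow> s j = s' j; M s < M s'\<rbrakk>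
      \<Longrightarrow> pos s' < pos s"
    and step: "\<lbrakk>s \<in> profiles n k; s' \<in> profiles n k; pos s' = Suc (pos s)\<rbrakk>
      \<Longrightarrow> (\<forall>j. j \<noteq> 1 \<longrightarrow> s j = s' j) \<and> M s < M s' \<or>
          a s = a s' \<and> (\<forall>j. j \<noteq> a s \<longrightarrow> s j = s' j) \<and> M s' < M s"
begin

text \<open>
  Since \<open>M\<close> is injective with integer values, discounting by \<open>1/2\<close> breaks ties between agents
  without changing any signal order.
\<close>

definition inst :: "(nat \<times> profile) set \<Rightarrow> valuation" where
  "inst D i s = (if i = 1 \<or> i = a s then real (M s) - (if (i, s) \<in> D then 1/2 else 0) else 1)"

text \<open>Witnesses for the promise: the 0/1 step functions along the path that are nondecreasing
  for agent 1.\<close>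

definition threshold :: "nat \<Rightarrow> allocation" where
  "threshold \<theta> i s = of_bool (if \<theta> \<le> pos s then i = 1 else i = a s)"

lemma is_instance_inst: "is_instance n k (inst D)"
  using M_ge by (fastforce simp: is_instance_def inst_def)

text \<open>The gap between the integers \<open>M s\<close> and \<open>M s'\<close> exceeds any
  discount. Agent \<open>i\<close> need not be tied at \<open>s\<close>: its value there is then 1,
  still below \<open>2 - 1/2\<close>.\<close>

lemma inst_less:
  assumes "i = 1 \<or> i = a s'" "s \<in> profiles n k" "s' \<in> profiles n k" "M s < M s'"
  shows "inst D i s < inst D i s'"
  using assms M_ge[of s'] by (auto simp: inst_def)

lemma sum_threshold:
  assumes "s \<in> profiles n k"
  shows "(\<Sum>i\<in>{1..n}. threshold \<theta> i s) = 1"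
  using a[OF assms] n by (cases "\<theta> \<le> pos s") (auto simp: threshold_def of_bool_def)

text \<open>As long as no discounted pair in \<open>D\<close> is served, the agent served at each
  profile still has maximal value; truthfulness comes from \<open>up\<close> and
  \<open>down\<close>.\<close>

lemma solution_threshold:
  assumes D: "\<And>i s. s \<in> profiles n k \<Longrightarrow> (i, s) \<in> D \<Longrightarrow> threshold \<theta> i s = 0"
  shows "solution P n k 1 (inst D) (threshold \<theta>)"
proof (rule optimal_solutionI[OF is_instance_inst k])
  have mono: "threshold \<theta> i s \<le> threshold \<theta> i s'"
    if i: "i \<in> {1..n}" and s: "s \<in> profiles n k" "s' \<in> profiles n k"
      and agree: "\<And>j. j \<noteq> i \<Longrightarrow> s j = s' j" and less: "inst D i s < inst D i s'" for i s s'
  proof (cases "i = 1 \<or> i = a s")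
    case False
    then show ?thesis by (auto simp: threshold_def)
  next
    case True
    \<comment> \<open>A tied agent has value at least 3/2 at \<open>s\<close>, so a larger value at
      \<open>s'\<close> cannot be the default 1.\<close>
    have tied': "i = 1 \<or> i = a s'"
      using True less M_ge[OF s(1)] by (auto simp: inst_def split: if_splits)
    \<comment> \<open>Injectivity rules out that the discount alone separates the two
      values.\<close>
    have "M s \<noteq> M s'" using M_inj s less by (auto dest: inj_onD)
    then have M: "M s < M s'"
      using less inst_less[of i s s' D] inst_less[of i s' s D] True tied' s by fastforce
    show ?thesis
    proof (cases "i = 1")
      case True
      then show ?thesis
        using up[OF s _ M] agree a[OF s(1)] a[OF s(2)] by (auto simp: threshold_def)
    next
      case False
      then show ?thesis
        using down[OF s False agree M] True tied' by (auto simp: threshold_def)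
    qed
  qed
  have "threshold \<theta> \<in> truthful n k (signal_order k (inst D))"
    by (rule truthfulI) (simp add: threshold_def, rule sum_threshold, assumption, rule mono)
  then show "threshold \<theta> \<in> truthful_det n k (signal_order k (inst D))"
    by (auto simp: truthful_det_def threshold_def)
next
  fix i j s
  assume s: "s \<in> profiles n k" and less: "inst D i s < inst D j s"
  show "threshold \<theta> i s = 0"
  proof (cases "i = 1 \<or> i = a s")
    case True
    then have "(i, s) \<in> D" using less M_ge[OF s] by (auto simp: inst_def split: if_splits)
    then show ?thesis using D s by blast
  qed (auto simp: threshold_def)
qed

lemma promise_inst:
  assumes "\<And>i s. s \<in> profiles n k \<Longrightarrow> (i, s) \<in> D \<Longrightarrow> threshold \<theta> i s = 0"
  shows "promise P n k 1 (inst D)"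
  using solution_threshold[OF assms] is_instance_inst by (auto simp: promise_def)

section \<open>Properties of every solution of a chain instance\<close>

context
  fixes P D x
  assumes x: "solution P n k 1 (inst D) x"
begin

lemma solution_truthful: "x \<in> truthful n k (signal_order k (inst D))"
  using x by (cases P) (auto simp: truthful_det_def)

text \<open>Untied agents have value 1, whereas agent 1 keeps at least 3/2 even when discounted; so
  only the tied pair can be served.\<close>

lemma solution_tied:
  assumes s: "s \<in> profiles n k"
  shows "x 1 s + x (a s) s = 1"
proof -
  have "x i s = 0" if "i \<in> {1..n} - {1, a s}" for i
    using that n a[OF s] M_ge[OF s]
    by (intro optimal_solution_support[OF is_instance_inst x s, of i 1]) (auto simp: inst_def)
  then have "(\<Sum>i\<in>{1..n}. x i s) = (\<Sum>i\<in>{1, a s}. x i s)"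
    using n a[OF s] by (intro sum.mono_neutral_right) auto
  then show ?thesis
    using solution_truthful s a[OF s] by (auto simp: truthful_def)
qed

text \<open>In the first case of \<open>step\<close>, agent 1's own constraint applies. In the
  second, the shared partner's probability cannot grow along the path, and agent 1 receives the
  complement.\<close>

lemma solution_step:
  assumes s: "s \<in> profiles n k" "s' \<in> profiles n k" and "pos s' = Suc (pos s)"
  shows "x 1 s \<le> x 1 s'"
  using step[OF assms]
proof
  assume *: "(\<forall>j. j \<noteq> 1 \<longrightarrow> s j = s' j) \<and> M s < M s'"
  show ?thesis
    by (rule truthful_mono[OF solution_truthful _ s]) (use * n s inst_less in auto)
next
  assume *: "a s = a s' \<and> (\<forall>j. j \<noteq> a s \<longrightarrow> s j = s' j) \<and> M s' < M s"
  have "x (a s) s' \<le> x (a s) s"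
    by (rule truthful_mono[OF solution_truthful _ s(2,1)]) (use * a[OF s(1)] s inst_less in auto)
  then show ?thesis using solution_tied[OF s(1)] solution_tied[OF s(2)] * by simp
qed

lemma solution_mono:
  assumes "s \<in> profiles n k" "s' \<in> profiles n k" "pos s \<le> pos s'"
  shows "x 1 s \<le> x 1 s'"
proof -
  have "x 1 s \<le> x 1 s'" if "s' \<in> profiles n k" "pos s' = pos s + d" for d s'
    using that
  proof (induction d arbitrary: s')
    case 0
    then have "s' = s" using pos assms(1) by (auto simp: bij_betw_def dest: inj_onD)
    then show ?case by simp
  next
    case (Suc d)
    have "pos s + d \<in> pos ` profiles n k"
      using Suc.prems bij_betwE[OF pos] unfolding bij_betw_imp_surj_on[OF pos] by fastforce
    then obtain u where u: "u \<in> profiles n k" "pos u = pos s + d" by force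
    show ?case using Suc.IH[OF u] solution_step[OF u(1) Suc.prems(1)] u(2) Suc.prems(2) by simp
  qed
  then show ?thesis using assms(2,3) le_Suc_ex by blast
qed

text \<open>Discounting one agent of the tied pair makes it non-maximal, so the other receives
  everything.\<close>

lemma solution_discounted:
  assumes s: "s \<in> profiles n k"
  shows "D = {(1, s)} \<Longrightarrow> x 1 s = 0" "D = {(a s, s)} \<Longrightarrow> x 1 s = 1"
proof -
  show "x 1 s = 0" if "D = {(1, s)}"
    by (rule optimal_solution_support[OF is_instance_inst x s, of 1 "a s"])
      (use a[OF s] n that in \<open>auto simp: inst_def\<close>)
  have "x (a s) s = 0" if "D = {(a s, s)}"
    by (rule optimal_solution_support[OF is_instance_inst x s, of "a s" 1])
      (use a[OF s] n that in \<open>auto simp: inst_def\<close>)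
  then show "x 1 s = 1" if "D = {(a s, s)}" using that solution_tied[OF s] by simp
qed

lemma solution_bounds:
  assumes "s \<in> profiles n k"
  shows "0 \<le> x 1 s" "x 1 s \<le> 1"
proof -
  have nonneg: "0 \<le> x i s" if "i \<in> {1..n}" for i
    using solution_truthful assms that by (auto simp: truthful_def)
  show "0 \<le> x 1 s" using nonneg n by simp
  show "x 1 s \<le> 1" using nonneg[of "a s"] a[OF assms] solution_tied[OF assms] by simp
qed

end

text \<open>The hard query is the midpoint \<open>s\<close> of the path. Discounting the partner at
  some \<open>t\<close> up to \<open>s\<close> forces \<open>x 1 t = 1\<close>, hence
  \<open>x 1 s = 1\<close>; discounting agent 1 at some \<open>t\<close> from \<open>s\<close> on
  forces \<open>x 1 s = 0\<close>. Both ranges contain the midpoint, so each has at least half of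
  the profiles.\<close>

lemma requires_half:
  fixes orc :: "valuation \<Rightarrow> 'q \<Rightarrow> 'a" and prof :: "'q \<Rightarrow> profile"
  assumes "\<And>v v' q. (\<And>i. v i (prof q) = v' i (prof q)) \<Longrightarrow> orc v q = orc v' q"
  shows "requires_queries orc P n k 1 (1/2 * real k ^ n)"
proof -
  let ?N = "k ^ n"
  let ?h = "?N div 2"
  have N: "?N \<ge> 1" using k by simp
  then have "?h \<in> pos ` profiles n k" using pos by (auto simp: bij_betw_def)
  then obtain s where s: "s \<in> profiles n k" "pos s = ?h" by auto
  let ?B = "{t \<in> profiles n k. pos t \<le> ?h}"
  let ?C = "{t \<in> profiles n k. ?h \<le> pos t}"
  have card: "card {t \<in> profiles n k. pos t \<in> J} = card J" if "J \<subseteq> {..<?N}" for J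
  proof (rule bij_betw_same_card[of pos])
    show "bij_betw pos {t \<in> profiles n k. pos t \<in> J} J"
      by (rule bij_betw_subset[OF pos]) (use that bij_betw_imp_surj_on[OF pos] in auto)
  qed
  have "{..?h} \<subseteq> {..<?N}" using N by auto
  then have "card ?B = card {..?h}" using card[of "{..?h}"] by simp
  moreover have "card ?C = card {?h..<?N}"
  proof -
    have "?C = {t \<in> profiles n k. pos t \<in> {?h..<?N}}" using pos by (auto simp: bij_betw_def)
    moreover have "{?h..<?N} \<subseteq> {..<?N}" by auto
    ultimately show ?thesis by (simp only: card)
  qed
  ultimately have "?N \<le> 2 * card ?B" "?N \<le> 2 * card ?C" by simp_all
  then have "real ?N \<le> real (2 * card ?B)" "real ?N \<le> real (2 * card ?C)"
    unfolding of_nat_le_iff .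
  then have B: "1/2 * real k ^ n \<le> real (card ?B)" and C: "1/2 * real k ^ n \<le> real (card ?C)"
    by simp_all
  show ?thesis
  proof (rule requires_queriesI[where prof = prof and s = s and j = 1 and \<alpha> = 1 and \<beta> = 0
        and v = "inst {}" and B = ?B and C = ?C])
    show "orc v q = orc v' q" if "\<And>i. v i (prof q) = v' i (prof q)" for v v' q
      using that by (rule assms)
  next
    fix t assume "t \<in> ?B"
    then have t: "t \<in> profiles n k" "pos t \<le> pos s" using s(2) by auto
    \<comment> \<open>With threshold \<open>pos t\<close> agent 1 is already served at
      \<open>t\<close>, so the discounted partner is not.\<close>
    have "promise P n k 1 (inst {(a t, t)})"
      by (rule promise_inst[of _ "pos t"]) (use a[OF t(1)] in \<open>auto simp: threshold_def\<close>)
    moreover have "\<forall>x. solution P n k 1 (inst {(a t, t)}) x \<longrightarrow> x 1 s = 1"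
    proof (intro allI impI)
      fix x assume x: "solution P n k 1 (inst {(a t, t)}) x"
      show "x 1 s = 1"
        using solution_mono[OF x t(1) s(1) t(2)] solution_discounted(2)[OF x t(1)] solution_bounds[OF x s(1)]
        by simp
    qed
    moreover have "\<forall>i u. u \<noteq> t \<longrightarrow> inst {(a t, t)} i u = inst {} i u" by (simp add: inst_def)
    ultimately show "\<exists>w. promise P n k 1 w \<and> (\<forall>i u. u \<noteq> t \<longrightarrow> w i u = inst {} i u) \<and>
        (\<forall>x. solution P n k 1 w x \<longrightarrow> x 1 s = 1)"
      by (intro exI[of _ "inst {(a t, t)}"] conjI)
  next
    fix t assume "t \<in> ?C"
    then have t: "t \<in> profiles n k" "pos s \<le> pos t" using s(2) by auto
    \<comment> \<open>With threshold \<open>Suc (pos t)\<close> the partner is still served at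
      \<open>t\<close>, so the discounted agent 1 is not.\<close>
    have "promise P n k 1 (inst {(1, t)})"
      by (rule promise_inst[of _ "Suc (pos t)"]) (use a[OF t(1)] in \<open>auto simp: threshold_def\<close>)
    moreover have "\<forall>x. solution P n k 1 (inst {(1, t)}) x \<longrightarrow> x 1 s = 0"
    proof (intro allI impI)
      fix x assume x: "solution P n k 1 (inst {(1, t)}) x"
      show "x 1 s = 0"
        using solution_mono[OF x s(1) t(1,2)] solution_discounted(1)[OF x t(1)] solution_bounds[OF x s(1)]
        by simp
    qed
    moreover have "\<forall>i u. u \<noteq> t \<longrightarrow> inst {(1, t)} i u = inst {} i u" by (simp add: inst_def)
    ultimately show "\<exists>w. promise P n k 1 w \<and> (\<forall>i u. u \<noteq> t \<longrightarrow> w i u = inst {} i u) \<and>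
        (\<forall>x. solution P n k 1 w x \<longrightarrow> x 1 s = 0)"
      by (intro exI[of _ "inst {(1, t)}"] conjI)
  qed (use n s(1) B C promise_inst[of "{}" 0] in simp_all)
qed

end

section \<open>A Hamiltonian path of the grid\<close>

text \<open>Reflected Gray code: for each value of the new coordinate, the path for \<open>I\<close>
  is traversed once, in alternating directions, so that neighbouring layers meet over the same
  point.\<close>

lemma gray_code:
  fixes I :: "'i set" and k :: nat
  assumes "finite I" "k \<ge> 1"
  shows "\<exists>xs. distinct xs \<and> set xs = I \<rightarrow>\<^sub>E {1..k} \<and>
           successively (\<lambda>r r'. \<exists>i\<in>I. \<forall>j. j \<noteq> i \<longrightarrow> r j = r' j) xs"
  using assms(1)
proof induction
  case empty
  show ?case by (intro exI[of _ "[\<lambda>_. undefined]"]) auto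
next
  case (insert i I)
  let ?R = "\<lambda>I r r'. \<exists>i\<in>I. \<forall>j. j \<noteq> i \<longrightarrow> (r :: 'i \<Rightarrow> nat) j = r' j"
  from insert.IH obtain xs where xs: "distinct xs" "set xs = I \<rightarrow>\<^sub>E {1..k}" "successively (?R I) xs"
    by blast
  have "set xs \<noteq> {}" unfolding xs(2) using \<open>k \<ge> 1\<close> by (auto simp: PiE_eq_empty_iff)
  then have ne: "xs \<noteq> []" by auto
  \<comment> \<open>All elements agree at the new coordinate, so overwriting it loses no
    information.\<close>
  have xi: "r i = undefined" if "r \<in> set xs" for r
    using that insert.hyps unfolding xs(2) by (auto simp: PiE_def extensional_def)
  have layer: "distinct (map (\<lambda>r. r(i := b)) zs)" "successively (?R (insert i I)) (map (\<lambda>r. r(i := b)) zs)"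
    if zs: "zs = xs \<or> zs = rev xs" for zs and b :: nat
  proof -
    have "r = r'" if "r \<in> set zs" "r' \<in> set zs" "r(i := b) = r'(i := b)" for r r'
    proof
      fix j show "r j = r' j"
        using that(1,2) zs xi[of r] xi[of r'] fun_cong[OF that(3), of j]
        by (cases "j = i") auto
    qed
    then show "distinct (map (\<lambda>r. r(i := b)) zs)"
      using xs(1) zs by (auto simp: distinct_map inj_on_def)
    have "successively (?R I) zs"
      using zs xs(3) by (auto simp: successively_rev elim!: successively_mono) (metis)
    then show "successively (?R (insert i I)) (map (\<lambda>r. r(i := b)) zs)"
      unfolding successively_map by (rule successively_mono) auto
  qed
  \<comment> \<open>Induction on the number \<open>m\<close> of layers. Recording that the path ends
    over an endpoint of \<open>xs\<close> allows the next layer to start there, with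
    \<open>xs\<close> or \<open>rev xs\<close>.\<close>
  have "\<exists>ys. distinct ys \<and> set ys = (\<Union>b\<in>{1..m}. (\<lambda>r. r(i := b)) ` set xs) \<and>
      successively (?R (insert i I)) ys \<and> ys \<noteq> [] \<and>
      (last ys = (last xs)(i := m) \<or> last ys = (hd xs)(i := m))" if "m \<ge> 1" for m :: nat
    using that
  proof (induction m rule: dec_induct)
    case base
    have "set (map (\<lambda>r. r(i := 1)) xs) = (\<Union>b\<in>{1..1}. (\<lambda>r. r(i := b)) ` set xs)"
      unfolding atLeastAtMost_singleton set_map by blast
    with layer[of xs 1] ne show ?case
      by (intro exI[of _ "map (\<lambda>r. r(i := 1)) xs"] conjI disjI1 last_map)
        (assumption | simp only: simp_thms list.map_disc_iff)+
  next
    case (step m)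
    then obtain ys where ys: "distinct ys" "set ys = (\<Union>b\<in>{1..m}. (\<lambda>r. r(i := b)) ` set xs)"
      "successively (?R (insert i I)) ys" "ys \<noteq> []"
      "last ys = (last xs)(i := m) \<or> last ys = (hd xs)(i := m)" by blast
    obtain zs where zs: "zs = xs \<or> zs = rev xs" "last ys = (hd zs)(i := m)"
      using ys(5) ne by (metis hd_rev)
    let ?zs = "map (\<lambda>r. r(i := Suc m)) zs"
    have zs': "set zs = set xs" "zs \<noteq> []" "last zs = last xs \<or> last zs = hd xs"
      using zs(1) ne by (auto simp: last_rev)
    have "set ys \<inter> set ?zs = {}"
      unfolding ys(2) by (auto dest!: fun_cong[of _ _ i])
    then have "distinct (ys @ ?zs)"
      unfolding distinct_append using ys(1) layer(1)[OF zs(1)] by blast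
    moreover have "set (ys @ ?zs) = (\<Union>b\<in>{1..Suc m}. (\<lambda>r. r(i := b)) ` set xs)"
      using zs'(1) by (simp add: ys(2) atLeastAtMostSuc_conv Un_commute)
    moreover have "?R (insert i I) (last ys) (hd ?zs)"
      using zs(2) zs'(2) by (auto simp: hd_map)
    then have "successively (?R (insert i I)) (ys @ ?zs)"
      unfolding successively_append_iff using ys(3) layer(2)[OF zs(1)] by blast
    moreover have "ys @ ?zs \<noteq> []" using ys(4) by simp
    moreover have "last (ys @ ?zs) = (last xs)(i := Suc m) \<or> last (ys @ ?zs) = (hd xs)(i := Suc m)"
      using zs'(2,3) by (auto simp: last_map)
    ultimately show ?case by blast
  qed
  from this[OF \<open>k \<ge> 1\<close>] obtain ys where "distinct ys"
    "set ys = (\<Union>b\<in>{1..k}. (\<lambda>r. r(i := b)) ` set xs)" "successively (?R (insert i I)) ys"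
    by blast
  moreover have "(\<Union>b\<in>{1..k}. (\<lambda>r. r(i := b)) ` set xs) = insert i I \<rightarrow>\<^sub>E {1..k}"
  proof -
    have "(\<Union>b\<in>A. F b ` B) = (\<lambda>(b, r). F b r) ` (A \<times> B)"
      for F :: "nat \<Rightarrow> ('i \<Rightarrow> nat) \<Rightarrow> 'i \<Rightarrow> nat" and A B by auto
    then show ?thesis unfolding xs(2) PiE_insert_eq .
  qed
  ultimately show ?case by (intro exI[of _ ys] conjI) simp_all
qed

section \<open>Numbering the grid line by line\<close>

text \<open>
  The lines in direction 1 are traversed alternately upwards and downwards, in the order of a Gray
  code \<open>g\<close> on the other coordinates. \<open>M\<close> increases within a line and decreases from each line to
  the next; the partner of agent 1 at both ends of a line is the coordinate in which \<open>g\<close> changes.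
\<close>

lemma tied_chain_exists:
  assumes n: "n \<ge> 2" and k: "k \<ge> 2"
  shows "\<exists>pos M a. tied_chain n k pos M a"
proof -
  obtain gs where gs: "distinct gs" "set gs = {2..n} \<rightarrow>\<^sub>E {1..k}"
    "successively (\<lambda>r r'. \<exists>i\<in>{2..n}. \<forall>j. j \<noteq> i \<longrightarrow> r j = r' j) gs"
    using gray_code[of "{2..n}" k] k by auto
  define L where "L = k ^ (n - 1)"
  have len: "length gs = L"
    using distinct_card[OF gs(1)] unfolding gs(2) by (simp add: card_PiE L_def)
  have Lk: "L * k = k ^ n" using n by (cases n) (auto simp: L_def)
  define g where "g = nth gs"
  have g: "g \<tau> \<in> {2..n} \<rightarrow>\<^sub>E {1..k}" if "\<tau> < L" for \<tau>
    using that len gs(2) nth_mem[of \<tau> gs] by (auto simp: g_def)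
  have g1: "g \<tau> 1 = undefined" if "\<tau> < L" for \<tau>
    using g[OF that] by (auto simp: PiE_def extensional_def)
  have g_inj: "\<tau> = \<tau>'" if "\<tau> < L" "\<tau>' < L" "g \<tau> = g \<tau>'" for \<tau> \<tau>'
    using that gs(1) len by (auto simp: g_def nth_eq_iff_index_eq)
  have "\<exists>i\<in>{2..n}. \<forall>j. j \<noteq> i \<longrightarrow> g \<tau> j = g (Suc \<tau>) j" if "Suc \<tau> < L" for \<tau>
    using that gs(3) len unfolding g_def successively_conv_nth by auto
  then obtain d where d: "\<And>\<tau>. Suc \<tau> < L \<Longrightarrow> d \<tau> \<in> {2..n}"
    "\<And>\<tau> j. Suc \<tau> < L \<Longrightarrow> j \<noteq> d \<tau> \<Longrightarrow> g \<tau> j = g (Suc \<tau>) j" by metis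

  \<comment> \<open>Position \<open>m\<close> lies on line \<open>m div k\<close>; \<open>c\<close>
    is the signal of agent 1 there and \<open>u\<close> the whole profile. The values
    \<open>H\<close> fill disjoint blocks of \<open>k\<close> integers, one per line, the last block
    starting at \<open>k\<close>. In \<open>b\<close>, the two ends of a line are different
    positions because \<open>k \<ge> 2\<close>; the default 2 is an agent because
    \<open>n \<ge> 2\<close>.\<close>
  define c where "c m = (if even (m div k) then m mod k + 1 else k - m mod k)" for m
  define u where "u m = (g (m div k))(1 := c m)" for m
  define H where "H m = (L - m div k) * k + m mod k" for m
  define b where "b m = (if m mod k = k - 1 \<and> Suc (m div k) < L then d (m div k)
    else if m mod k = 0 \<and> 0 < m div k then d (m div k - 1) else 2)" for m
  define pos where "pos = inv_into {..<k ^ n} u"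

  have line: "m div k < L" if "m < k ^ n" for m
    using that Lk by (metis less_mult_imp_div_less)
  have mod: "m mod k < k" for m using k by simp
  have u_off: "u m j = g (m div k) j" if "j \<noteq> 1" for m j using that by (simp add: u_def)
  have same_line: "m div k = m' div k"
    if "m < k ^ n" "m' < k ^ n" "\<And>j. j \<noteq> 1 \<Longrightarrow> u m j = u m' j" for m m'
  proof (rule g_inj[OF line[OF that(1)] line[OF that(2)]], rule ext)
    fix j show "g (m div k) j = g (m' div k) j"
      using that(3)[of j] g1[OF line[OF that(1)]] g1[OF line[OF that(2)]]
        u_off[of j m] u_off[of j m'] by (cases "j = 1") auto
  qed
  have eqI: "m = m'" if "m div k = m' div k" "m mod k = m' mod k" for m m'
    using that by (metis div_mult_mod_eq)
  have u_inj: "inj_on u {..<k ^ n}"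
  proof (rule inj_onI)
    fix m m' assume m: "m \<in> {..<k ^ n}" "m' \<in> {..<k ^ n}" and eq: "u m = u m'"
    have div: "m div k = m' div k" using same_line[of m m'] m eq by auto
    have "c m = c m'" using fun_cong[OF eq, of 1] by (simp add: u_def)
    then have "m mod k = m' mod k"
      using div mod[of m] mod[of m'] by (auto simp: c_def split: if_splits)
    with div show "m = m'" by (rule eqI)
  qed
  have c: "c m \<in> {1..k}" for m using mod[of m] by (auto simp: c_def)
  have u_in: "u m \<in> profiles n k" if "m < k ^ n" for m
  proof -
    have "{1..n} = insert 1 {2..n}" using n by auto
    then show ?thesis
      using g[OF line[OF that]] c[of m] by (auto simp: profiles_def PiE_insert_eq u_def)
  qed
  have bij: "bij_betw u {..<k ^ n} (profiles n k)"
    unfolding bij_betw_def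
  proof (intro conjI u_inj card_subset_eq finite_profiles)
    show "card (u ` {..<k ^ n}) = card (profiles n k)"
      by (simp add: card_image[OF u_inj] card_profiles)
  qed (use u_in in auto)
  have bij': "bij_betw pos (profiles n k) {..<k ^ n}"
    unfolding pos_def by (rule bij_betw_inv_into[OF bij])
  have pos_lt: "pos s < k ^ n" and u_pos: "u (pos s) = s" if "s \<in> profiles n k" for s
    using that bij bij' by (auto simp: pos_def bij_betw_def f_inv_into_f)

  have H_later: "H m' < H m" if "m' < k ^ n" "m div k < m' div k" for m m'
  proof -
    have "Suc (L - m' div k) \<le> L - m div k" using that line[OF that(1)] by linarith
    then have "Suc (L - m' div k) * k \<le> (L - m div k) * k" by (rule mult_le_mono1)
    then show ?thesis using mod[of m'] by (simp add: H_def)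
  qed
  have H_inj: "m = m'" if "m < k ^ n" "m' < k ^ n" "H m = H m'" for m m'
  proof (rule eqI)
    show div: "m div k = m' div k"
      using H_later[of m m'] H_later[of m' m] that
      by (cases "m div k" "m' div k" rule: linorder_cases) auto
    show "m mod k = m' mod k" using that(3) unfolding H_def div by simp
  qed
  have H_ge: "2 \<le> H m" if "m < k ^ n" for m
  proof -
    have "1 * k \<le> (L - m div k) * k" using line[OF that] by (intro mult_le_mono1) simp
    then show ?thesis using k unfolding H_def by linarith
  qed
  have b: "b m \<in> {2..n}" if "m < k ^ n" for m
    using d(1)[of "m div k"] d(1)[of "m div k - 1"] line[OF that] n by (auto simp: b_def)
  have div_mono: "m < m'" if "m div k < m' div k" for m m'
    using that by (meson div_le_mono not_le)

  have "tied_chain n k pos (\<lambda>s. H (pos s)) (\<lambda>s. b (pos s))"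
  proof
    show "inj_on (\<lambda>s. H (pos s)) (profiles n k)"
      using H_inj pos_lt bij' by (metis (no_types, lifting) bij_betw_def inj_on_def)
  next
    fix s s' assume s: "s \<in> profiles n k" "s' \<in> profiles n k" and agree: "\<And>j. j \<noteq> 1 \<Longrightarrow> s j = s' j"
      and less: "H (pos s) < H (pos s')"
    have "pos s div k = pos s' div k"
      using same_line[of "pos s" "pos s'"] s agree pos_lt u_pos by simp
    with less have "pos s mod k < pos s' mod k" by (simp add: H_def)
    then show "pos s < pos s'"
      using \<open>pos s div k = pos s' div k\<close> by (metis div_mult_mod_eq nat_add_left_cancel_less)
  next
    fix s s' i assume s: "s \<in> profiles n k" "s' \<in> profiles n k" and "i \<noteq> 1"
      and agree: "\<And>j. j \<noteq> i \<Longrightarrow> s j = s' j" and less: "H (pos s) < H (pos s')"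
    \<comment> \<open>On a common line the profiles could differ only in coordinate 1, where they
      agree since \<open>i \<noteq> 1\<close>.\<close>
    have ne: "pos s div k \<noteq> pos s' div k"
    proof
      assume eq: "pos s div k = pos s' div k"
      have "s j = s' j" for j
        using agree[of j] \<open>i \<noteq> 1\<close> eq u_off[of j] u_pos s by (cases "j = i") metis+
      then have "s = s'" by blast
      with less show False by simp
    qed
    moreover have "\<not> pos s div k < pos s' div k"
      using H_later[of "pos s'" "pos s"] less pos_lt[OF s(2)] by auto
    ultimately have "pos s' div k < pos s div k" by simp
    then show "pos s' < pos s" by (rule div_mono)
  next
    fix s s' assume s: "s \<in> profiles n k" "s' \<in> profiles n k" and Suc: "pos s' = Suc (pos s)"
    let ?m = "pos s" and ?m' = "pos s'"
    show "(\<forall>j. j \<noteq> 1 \<longrightarrow> s j = s' j) \<and> H ?m < H ?m' \<or>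
      b ?m = b ?m' \<and> (\<forall>j. j \<noteq> b ?m \<longrightarrow> s j = s' j) \<and> H ?m' < H ?m"
    proof (cases "Suc (?m mod k) = k")
      case False
      then have "?m' div k = ?m div k" "?m' mod k = Suc (?m mod k)"
        unfolding Suc by (simp_all add: div_Suc mod_Suc)
      then have "H ?m < H ?m'" "s j = s' j" if "j \<noteq> 1" for j
        using u_off[OF that] u_pos s by (simp add: H_def, metis)
      \<comment> \<open>The inequality also stands under \<open>j \<noteq> 1\<close>;
        \<open>n_not_Suc_n\<close> provides such a \<open>j\<close>.\<close>
      then show ?thesis by (metis n_not_Suc_n)
    next
      case True
      then have m': "?m' div k = Suc (?m div k)" "?m' mod k = 0"
        unfolding Suc using k by (simp_all add: div_Suc mod_Suc)
      have L: "Suc (?m div k) < L" using line[OF pos_lt[OF s(2)]] m' by simp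
      have b_eq: "b ?m = d (?m div k)" "b ?m' = d (?m div k)"
        using True m' k L by (auto simp: b_def)
      \<comment> \<open>The parity flips, so the new line starts at the signal where the old one
        ended: \<open>k\<close> after an even line, 1 after an odd one.\<close>
      have "c ?m = c ?m'" using m' True by (auto simp: c_def)
      then have "u ?m j = u ?m' j" if "j \<noteq> d (?m div k)" for j
        using d(2)[OF L that] m' by (simp add: u_def)
      then show ?thesis
        using b_eq H_later[OF pos_lt[OF s(2)], of ?m] m' u_pos s by simp
    qed
  qed (use n k bij' H_ge b pos_lt in auto)
  then show ?thesis by blast
qed

section \<open>The lower bound for the four oracles\<close>

theorem theorem1p5:
  "\<exists>c::real. c > 0 \<and>
     (\<forall>(n::nat) k::nat. n \<ge> 2 \<longrightarrow> k \<ge> 2 \<longrightarrow>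
        (\<exists>\<gamma>::real. \<gamma> \<ge> 1 \<and>
           (\<forall>P::problem.
              requires_queries value_oracle P n k \<gamma> (c * real k ^ n) \<and>
              requires_queries cost_oracle P n k \<gamma> (c * real k ^ n) \<and>
              requires_queries (value_profile_oracle n) P n k \<gamma> (c * real k ^ n) \<and>
              requires_queries (cost_profile_oracle n) P n k \<gamma> (c * real k ^ n))))"
proof (rule exI[of _ "1/2"], intro conjI[of "0 < _"] allI impI)
  fix n k :: nat
  assume "n \<ge> 2" "k \<ge> 2"
  then obtain pos M a where "tied_chain n k pos M a" using tied_chain_exists by blast
  then interpret tied_chain n k pos M a .
  show "\<exists>\<gamma>::real. \<gamma> \<ge> 1 \<and>
           (\<forall>P::problem.
              requires_queries value_oracle P n k \<gamma> (1/2 * real k ^ n) \<and>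
              requires_queries cost_oracle P n k \<gamma> (1/2 * real k ^ n) \<and>
              requires_queries (value_profile_oracle n) P n k \<gamma> (1/2 * real k ^ n) \<and>
              requires_queries (cost_profile_oracle n) P n k \<gamma> (1/2 * real k ^ n))"
  proof (intro exI[of _ 1] conjI allI)
    fix P
    \<comment> \<open>A query for one number concerns the profile in its second component; a profile
      query is that profile itself. Costs at a profile are determined by the values there.\<close>
    show "requires_queries value_oracle P n k 1 (1/2 * real k ^ n)"
      "requires_queries cost_oracle P n k 1 (1/2 * real k ^ n)"
      by (rule requires_half[of snd]; auto simp: value_oracle_def cost_oracle_def cost_def)+
    show "requires_queries (value_profile_oracle n) P n k 1 (1/2 * real k ^ n)"
      "requires_queries (cost_profile_oracle n) P n k 1 (1/2 * real k ^ n)"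
      by (rule requires_half[of id];
        simp add: value_profile_oracle_def cost_profile_oracle_def cost_def cong: restrict_cong)+
  qed simp
qed simp

end
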